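(* Let $\mathcal{MES}$ be the set of all functions $f:\mathbb{R}\to\mathbb{R}$ that are Lebesgue measurable and everywhere surjective. Then $\mathcal{MES}$ is $\mathfrak{c}$-lineable; that is, there exists a vector subspace $M$ of the real vector space $\mathbb{R}^{\mathbb{R}}$ of all functions $\mathbb{R}\to\mathbb{R}$ such that $\dim(M)=\mathfrak{c}$ and $M\setminus\{0\}\subset\mathcal{MES}$.
   Context: $\mathfrak{c}$ denotes the cardinality of the continuum. A function $f:\mathbb{R}\to\mathbb{R}$ is everywhere surjective if it takes every real value in every nonempty open set, i.e. $f(I)=\mathbb{R}$ for every non-degenerate interval $I\subset\mathbb{R}$. If $X$ is a vector space, $A\subset X$ and $\alpha$ is a cardinal number, $A$ is called $\alpha$-lineable if there is a vector subspace $M\subset X$ with $\dim(M)=\alpha$ and $M\setminus\{0\}\subset A$. *)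

theory Defs
  imports "HOL-Analysis.Analysis" "HOL-Library.Function_Algebras"
begin

unbundle cardinal_syntax

text \<open>The pointwise vector space structure on functions; the additive structure is the one of
  \<open>Function_Algebras\<close>.\<close>

instantiation "fun" :: (type, scaleR) scaleR
begin

definition scaleR_fun :: "real \<Rightarrow> ('a \<Rightarrow> 'b) \<Rightarrow> 'a \<Rightarrow> 'b" where
  "scaleR_fun c f = (\<lambda>x. c *\<^sub>R f x)"

instance ..

end

instance "fun" :: (type, real_vector) real_vector
  by standard (simp_all add: scaleR_fun_def plus_fun_def fun_eq_iff
      scaleR_add_right scaleR_add_left)

text \<open>The library constant \<open>dim\<close> is natural-number valued and vanishes on infinite-dimensional
  spaces, so the dimension is expressed as the cardinal of a Hamel basis. Cardinal numbers are
  compared up to \<open>=o\<close>, as in the library of cardinals in \<open>Main\<close>.\<close>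

definition has_dimension :: "'a::real_vector set \<Rightarrow> 'c rel \<Rightarrow> bool" where
  "has_dimension M \<alpha> \<longleftrightarrow> (\<exists>B. independent B \<and> span B = M \<and> |B| =o \<alpha>)"

definition lineable :: "'c rel \<Rightarrow> 'a::real_vector set \<Rightarrow> bool" where
  "lineable \<alpha> A \<longleftrightarrow> (\<exists>M. subspace M \<and> has_dimension M \<alpha> \<and> M - {0} \<subseteq> A)"

abbreviation continuum :: "real rel" where
  "continuum \<equiv> |UNIV :: real set|"

definition everywhere_surjective :: "(real \<Rightarrow> real) \<Rightarrow> bool" where
  "everywhere_surjective f \<longleftrightarrow> (\<forall>U. open U \<and> U \<noteq> {} \<longrightarrow> f ` U = UNIV)"

lemma everywhere_surjective_iff_interval:
  "everywhere_surjective f \<longleftrightarrow>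
    (\<forall>I. is_interval I \<and> (\<exists>a\<in>I. \<exists>b\<in>I. a < b) \<longrightarrow> f ` I = UNIV)"
proof
  assume f: "everywhere_surjective f"
  show "\<forall>I. is_interval I \<and> (\<exists>a\<in>I. \<exists>b\<in>I. a < b) \<longrightarrow> f ` I = UNIV"
  proof (intro allI impI)
    fix I :: "real set"
    assume I: "is_interval I \<and> (\<exists>a\<in>I. \<exists>b\<in>I. a < b)"
    then obtain a b where ab: "a \<in> I" "b \<in> I" "a < b" by blast
    have "{a<..<b} \<subseteq> I"
      using I ab(1,2) unfolding is_interval_1 by (meson greaterThanLessThan_iff less_imp_le subsetI)
    moreover have "f ` {a<..<b} = UNIV"
      using f ab(3) unfolding everywhere_surjective_def
      by (simp add: open_greaterThanLessThan)
    ultimately show "f ` I = UNIV" by blast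
  qed
next
  assume f: "\<forall>I. is_interval I \<and> (\<exists>a\<in>I. \<exists>b\<in>I. a < b) \<longrightarrow> f ` I = UNIV"
  show "everywhere_surjective f"
    unfolding everywhere_surjective_def
  proof (intro allI impI)
    fix U :: "real set"
    assume "open U \<and> U \<noteq> {}"
    then obtain x e where e: "e > 0" "cball x e \<subseteq> U"
      using open_contains_cball by blast
    have "f ` {x - e..x + e} = UNIV"
    proof (rule f[rule_format], intro conjI is_interval_cc)
      show "\<exists>a\<in>{x - e..x + e}. \<exists>b\<in>{x - e..x + e}. a < b"
        using e(1) by (intro bexI[of _ "x - e"] bexI[of _ "x + e"]) simp_all
    qed
    moreover have "{x - e..x + e} \<subseteq> U"
      using e(2) by (simp add: cball_eq_atLeastAtMost)
    ultimately show "f ` U = UNIV" by blast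
  qed
qed

definition MES :: "(real \<Rightarrow> real) set" where
  "MES = {f. f \<in> borel_measurable lebesgue \<and> everywhere_surjective f}"

end

(*
The ternary Cantor set K is null and has the cardinality of the continuum. Choosing one
representative of each class of K modulo the rationals gives a set R with K contained in R + Q, so R
still has the cardinality of the continuum. Sending every rational translate of a point of R to the
image of that point under a surjection from R to the reals, and everything outside the null set K + Q
to 0, gives an everywhere surjective f that vanishes off a null set. If h is a surjection with
h(0) = 0, the composition h o f has the same properties, hence is Lebesgue measurable. The functions
h(y) = sinh(a y), a > 0, are such that every nontrivial linear combination is odd, continuous and
dominated at infinity by its largest exponent, hence surjective; composing them with f gives the basis.
*)
theory Submission
  imports Defs "HOL-Real_Asymp.Real_Asymp"
begin

section \<open>The ternary Cantor set: coding by digits, measure and cardinality\<close>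

definition cantor_point :: "(nat \<Rightarrow> bool) \<Rightarrow> real" where
  "cantor_point b = (\<Sum>n. (if b n then 2 else 0) / 3 ^ Suc n)"

lemma cantor_point_summable: "summable (\<lambda>n. (if b n then 2 else 0) / 3 ^ Suc n :: real)"
proof (rule summable_comparison_test')
  show "summable (\<lambda>n. 2 * (1 / 3) ^ Suc n :: real)"
    by (intro summable_mult) (simp add: summable_geometric)
  show "norm ((if b n then 2 else 0) / 3 ^ Suc n :: real) \<le> 2 * (1 / 3) ^ Suc n" if "0 \<le> n" for n
    by (simp add: power_divide)
qed

lemma cantor_point_bounds: "cantor_point b \<in> {0..1}"
proof -
  have s: "(\<lambda>n. (2 / 3) * (1 / 3) ^ n :: real) sums ((2 / 3) * (1 / (1 - 1 / 3)))"
    by (intro sums_mult geometric_sums) simp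
  have "cantor_point b \<le> (\<Sum>n. (2 / 3) * (1 / 3) ^ n)"
    unfolding cantor_point_def
    by (intro suminf_le cantor_point_summable sums_summable[OF s]) (simp add: power_divide)
  moreover have "(\<Sum>n. (2 / 3) * (1 / 3) ^ n :: real) = 1"
    using sums_unique[OF s] by simp
  moreover have "0 \<le> cantor_point b"
    unfolding cantor_point_def by (intro suminf_nonneg cantor_point_summable) simp
  ultimately show ?thesis by simp
qed

text \<open>Self-similarity of the Cantor set: dropping the first digit rescales by 3. Both
  injectivity and the covering by short intervals are inductions over this identity.\<close>

lemma cantor_point_shift:
  "cantor_point b = ((if b 0 then 2 else 0) + cantor_point (\<lambda>n. b (Suc n))) / 3"
proof -
  have "cantor_point (\<lambda>n. b (Suc n)) / 3 = (\<Sum>n. (if b (Suc n) then 2 else 0) / 3 ^ Suc (Suc n))"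
    unfolding cantor_point_def
    by (subst suminf_divide[symmetric, OF cantor_point_summable]) (simp add: field_simps)
  then show ?thesis
    using suminf_split_head[OF cantor_point_summable[of b]]
    by (simp add: cantor_point_def)
qed

text \<open>The value lies in [0, 1/3] or in [2/3, 1] according to the first digit, so it determines
  that digit; the tails then have equal values and the argument repeats.\<close>

lemma inj_cantor_point: "inj cantor_point"
proof (rule injI)
  fix b c assume eq: "cantor_point b = cantor_point c"
  have "b n = c n" if "cantor_point b = cantor_point c" for n b c
    using that
  proof (induction n arbitrary: b c)
    case 0
    then show ?case
      using cantor_point_shift[of b] cantor_point_shift[of c]
        cantor_point_bounds[of "\<lambda>n. b (Suc n)"] cantor_point_bounds[of "\<lambda>n. c (Suc n)"]
      by (auto split: if_splits)
  next
    case (Suc n)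
    then have "cantor_point (\<lambda>n. b (Suc n)) = cantor_point (\<lambda>n. c (Suc n))"
      using cantor_point_shift[of b] cantor_point_shift[of c]
        cantor_point_bounds[of "\<lambda>n. b (Suc n)"] cantor_point_bounds[of "\<lambda>n. c (Suc n)"]
      by (auto split: if_splits)
    from Suc.IH[OF this] show ?case .
  qed
  with eq show "b = c" by blast
qed

text \<open>The two contractions d / 3 and (2 + d) / 3, one for each first digit, turn a cover of
  level n into one of level n + 1 with at most twice as many intervals, each a third as
  long.\<close>

lemma cantor_point_cover:
  "\<exists>D. finite D \<and> card D \<le> 2 ^ n \<and> range cantor_point \<subseteq> (\<Union>d\<in>D. {d..d + 1 / 3 ^ n})"
proof (induction n)
  case 0
  show ?case using cantor_point_bounds by (intro exI[of _ "{0}"]) auto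
next
  case (Suc n)
  then obtain D where D: "finite D" "card D \<le> 2 ^ n"
      "range cantor_point \<subseteq> (\<Union>d\<in>D. {d..d + 1 / 3 ^ n})"
    by blast
  let ?D = "(\<lambda>d. d / 3) ` D \<union> (\<lambda>d. (2 + d) / 3) ` D"
  have "card ?D \<le> card D + card D"
    by (intro order_trans[OF card_Un_le] add_mono card_image_le D)
  moreover have "cantor_point b \<in> (\<Union>d\<in>?D. {d..d + 1 / 3 ^ Suc n})" for b
  proof -
    obtain d where "d \<in> D" "cantor_point (\<lambda>n. b (Suc n)) \<in> {d..d + 1 / 3 ^ n}"
      using D(3) by blast
    then show ?thesis
      unfolding cantor_point_shift[of b] by (auto simp: add_divide_distrib)
  qed
  ultimately show ?case
    using D(1,2) by (intro exI[of _ ?D] conjI image_subsetI) simp_all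
qed

text \<open>The cover of level n has total length at most (2/3)^n, which becomes arbitrarily
  small.\<close>

lemma negligible_range_cantor_point: "negligible (range cantor_point)"
  unfolding negligible_outer
proof (intro allI impI)
  fix e :: real assume "e > 0"
  then obtain n where n: "(2 / 3 :: real) ^ n < e"
    using real_arch_pow_inv[of e "2 / 3"] by auto
  obtain D where D: "finite D" "card D \<le> 2 ^ n"
      "range cantor_point \<subseteq> (\<Union>d\<in>D. {d..d + 1 / 3 ^ n})"
    using cantor_point_cover by blast
  have "measure lebesgue (\<Union>d\<in>D. {d..d + 1 / 3 ^ n}) \<le> (\<Sum>d\<in>D. measure lebesgue {d..d + 1 / 3 ^ n})"
    by (intro measure_UNION_le D) auto
  also have "\<dots> = real (card D) / 3 ^ n"
    by simp
  also have "\<dots> \<le> 2 ^ n / 3 ^ n"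
    using D(2) by (intro divide_right_mono) (auto simp: numeral_power_le_of_nat_cancel_iff)
  also have "\<dots> < e"
    using n by (simp add: power_divide)
  finally have "measure lebesgue (\<Union>d\<in>D. {d..d + 1 / 3 ^ n}) < e" .
  moreover have "(\<Union>d\<in>D. {d..d + 1 / 3 ^ n}) \<in> lmeasurable"
    using D(1) by (intro fmeasurable.finite_UN) auto
  ultimately show "\<exists>T. range cantor_point \<subseteq> T \<and> T \<in> lmeasurable \<and> measure lebesgue T < e"
    using D(3) by blast
qed

lemma continuum_le_cantor: "continuum \<le>o |range cantor_point|"
proof -
  \<comment> \<open>The lower Dedekind cut of \<open>r\<close>, written as a digit sequence along an
    enumeration of the rationals.\<close>
  define cut :: "real \<Rightarrow> nat \<Rightarrow> bool" where "cut r n \<longleftrightarrow> real_of_rat (from_nat n) < r" for r n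
  have "cut r \<noteq> cut s" if "r < s" for r s
  proof -
    obtain q where q: "r < real_of_rat q" "real_of_rat q < s"
      using of_rat_dense[OF \<open>r < s\<close>] by blast
    then have "cut r (to_nat q) \<noteq> cut s (to_nat q)"
      by (simp add: cut_def)
    then show ?thesis by metis
  qed
  then have "inj cut"
    by (metis injI linorder_less_linear)
  then have "inj (cantor_point \<circ> cut)"
    by (intro inj_compose inj_cantor_point)
  then show ?thesis
    by (intro card_of_ordLeq[THEN iffD1] exI[of _ "cantor_point \<circ> cut"]) auto
qed

section \<open>An everywhere surjective function supported on a null set\<close>

lemma exists_everywhere_surjective_null_support:
  "\<exists>f. everywhere_surjective f \<and> negligible {x. f x \<noteq> 0}"
proof -
  let ?K = "range cantor_point"
  \<comment> \<open>The choice depends on \<open>x\<close> only through the predicate on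
    \<open>k\<close>, so points that differ by a rational get the same representative.\<close>
  define r where "r x = (SOME k. k \<in> ?K \<and> x - k \<in> \<rat>)" for x
  have r: "r x \<in> ?K \<and> x - r x \<in> \<rat>" if "k \<in> ?K" "x - k \<in> \<rat>" for x k
    unfolding r_def using that by (intro someI) auto
  have r_cong: "r x = r y" if "x - y \<in> \<rat>" for x y
  proof -
    have "x - k \<in> \<rat> \<longleftrightarrow> y - k \<in> \<rat>" for k
      using Rats_diff[of "x - k" "x - y"] Rats_add[of "y - k" "x - y"] that by auto
    then show ?thesis by (simp add: r_def)
  qed
  have rr: "k - r k \<in> \<rat>" if "k \<in> ?K" for k
    using r[OF that, of k] by auto
  have unc: "\<not> countable ?K"
  proof
    assume "countable ?K"
    moreover obtain h :: "real \<Rightarrow> real" where "inj h" "range h \<subseteq> ?K"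
      using continuum_le_cantor card_of_ordLeq[of "UNIV :: real set" ?K] by blast
    ultimately have "countable (UNIV :: real set)"
      by (meson countable_image_inj_on countable_subset)
    then show False using uncountable_UNIV_real by blast
  qed
  have "?K \<subseteq> (\<lambda>(k, q). k + q) ` (r ` ?K \<times> \<rat>)"
  proof
    fix k assume k: "k \<in> ?K"
    then show "k \<in> (\<lambda>(k, q). k + q) ` (r ` ?K \<times> \<rat>)"
      using rr[OF k] by (intro image_eqI[of _ _ "(r k, k - r k)"]) auto
  qed
  then have le: "|?K| \<le>o |r ` ?K \<times> (\<rat> :: real set)|"
    by (rule surj_imp_ordLeq)
  \<comment> \<open>Countably many representatives would make \<open>?K\<close> countable, by the
    inclusion just proved. The set of representatives is therefore infinite and absorbs the
    countable factor \<rat> in the product.\<close>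
  have cR: "\<not> countable (r ` ?K)"
    using unc \<open>?K \<subseteq> _\<close> by (meson countable_SIGMA countable_image countable_rat countable_subset)
  then have inf: "infinite (r ` ?K)"
    using countable_finite by blast
  obtain h :: "real \<Rightarrow> nat" where "inj_on h \<rat>"
    using countable_rat by (rule countableE)
  then have "|\<rat> :: real set| \<le>o |UNIV :: nat set|"
    using card_of_ordLeq[of "\<rat> :: real set" "UNIV :: nat set"] by blast
  moreover have "|UNIV :: nat set| \<le>o |r ` ?K|"
    using inf infinite_iff_card_of_nat by blast
  ultimately have "|\<rat> :: real set| \<le>o |r ` ?K|"
    by (rule ordLeq_transitive)
  then have "|r ` ?K \<times> (\<rat> :: real set)| =o |r ` ?K|"
    using card_of_Times_infinite[OF inf, of "\<rat> :: real set"] Rats_0 by blast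
  with le continuum_le_cantor have "continuum \<le>o |r ` ?K|"
    using ordLeq_transitive ordLeq_ordIso_trans by blast
  then obtain s where s: "s ` r ` ?K = (UNIV :: real set)"
    using card_of_ordLeq2[of "UNIV :: real set" "r ` ?K"] by auto
  define f where "f x = (if \<exists>k\<in>?K. x - k \<in> \<rat> then s (r x) else 0)" for x
  have "everywhere_surjective f"
    unfolding everywhere_surjective_def
  proof (intro allI impI UNIV_eq_I[symmetric])
    fix U :: "real set" and y
    assume U: "open U \<and> U \<noteq> {}"
    \<comment> \<open>The value \<open>y\<close> is attained at \<open>k\<close>, hence at every
      rational translate of \<open>k\<close>, and these are dense.\<close>
    obtain k where k: "k \<in> ?K" "y = s (r k)"
      using s by blast
    obtain x e where e: "e > 0" "ball x e \<subseteq> U"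
      using U open_contains_ball by blast
    obtain q where q: "q \<in> \<rat>" "x - k < q" "q < x + e - k"
      using Rats_dense_in_real[of "x - k" "x + e - k"] e by auto
    then have "k + q \<in> U"
      using e by (auto simp: dist_real_def)
    moreover have "f (k + q) = y"
      using k(2) q(1) r_cong[of "k + q" k] bexI[of "\<lambda>k'. k + q - k' \<in> \<rat>", OF _ k(1)]
      by (simp add: f_def)
    ultimately show "y \<in> f ` U" by blast
  qed
  moreover have "negligible {x. f x \<noteq> 0}"
  proof (rule negligible_subset)
    \<comment> \<open>Off the countably many rational translates of the Cantor set, \<open>f\<close>
      takes its default value 0.\<close>
    show "negligible (\<Union>q\<in>\<rat>. (+) q ` ?K)"
      by (intro negligible_countable_Union countable_image countable_rat)
        (auto intro!: negligible_translation negligible_range_cantor_point)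
    show "{x. f x \<noteq> 0} \<subseteq> (\<Union>q\<in>\<rat>. (+) q ` ?K)"
    proof
      fix x assume "x \<in> {x. f x \<noteq> 0}"
      then obtain k where "k \<in> ?K" "x - k \<in> \<rat>"
        by (auto simp: f_def split: if_splits)
      then show "x \<in> (\<Union>q\<in>\<rat>. (+) q ` ?K)"
        by (intro UN_I[of "x - k"] image_eqI[of _ _ k]) auto
    qed
  qed
  ultimately show ?thesis by blast
qed

text \<open>Lebesgue measure is complete, so all subsets of the support are measurable. A preimage
  is such a subset or the complement of one, according to whether 0 lies in the target set.\<close>

lemma borel_measurable_lebesgue_if_negligible_support:
  fixes f :: "real \<Rightarrow> real"
  assumes "negligible {x. f x \<noteq> 0}"
  shows "f \<in> borel_measurable lebesgue"
proof (rule measurableI)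
  fix A :: "real set"
  have *: "S \<in> sets lebesgue" if "S \<subseteq> {x. f x \<noteq> 0}" for S
    using that assms negligible_subset negligible_imp_sets by blast
  show "f -` A \<inter> space lebesgue \<in> sets lebesgue"
  proof (cases "0 \<in> A")
    case True
    then have "f -` (- A) \<in> sets lebesgue"
      by (intro *) auto
    then have "space lebesgue - f -` (- A) \<in> sets lebesgue"
      by (rule sets.compl_sets)
    moreover have "space lebesgue - f -` (- A) = f -` A \<inter> space lebesgue"
      by auto
    ultimately show ?thesis by simp
  next
    case False
    then show ?thesis by (intro *) auto
  qed
qed auto

lemma MES_comp:
  assumes f: "everywhere_surjective f" "negligible {x. f x \<noteq> 0}" and h: "surj h" "h 0 = 0"
  shows "(\<lambda>x. h (f x)) \<in> MES"
proof -
  have "negligible {x. h (f x) \<noteq> 0}"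
    by (rule negligible_subset[OF f(2)]) (use h(2) in auto)
  moreover have "(\<lambda>x. h (f x)) ` U = UNIV" if "open U" "U \<noteq> {}" for U
  proof -
    have "(\<lambda>x. h (f x)) ` U = h ` f ` U" by auto
    then show ?thesis
      using f(1) h(1) that by (simp add: everywhere_surjective_def)
  qed
  ultimately show ?thesis
    by (simp add: MES_def everywhere_surjective_def borel_measurable_lebesgue_if_negligible_support)
qed

section \<open>Surjectivity of combinations of hyperbolic sines\<close>

lemma surj_odd_continuous:
  fixes h :: "real \<Rightarrow> real"
  assumes cont: "continuous_on UNIV h" and odd: "\<And>y. h (- y) = - h y"
    and lim: "filterlim h at_top at_top"
  shows "surj h"
proof -
  have "\<exists>x. h x = y" for y
  proof -
    have "eventually (\<lambda>t. \<bar>y\<bar> \<le> h t \<and> 0 \<le> t) at_top"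
      using lim by (intro eventually_conj eventually_ge_at_top) (simp add: filterlim_at_top)
    then obtain t where t: "\<bar>y\<bar> \<le> h t" "0 \<le> t"
      using eventually_happens[of _ "at_top :: real filter"] by auto
    \<comment> \<open>By oddness the values at -t and t enclose \<open>y\<close>, so the
      intermediate value theorem applies.\<close>
    have "\<exists>x\<ge>- t. x \<le> t \<and> h x = y"
      using t odd[of t] by (intro IVT' continuous_on_subset[OF cont]) auto
    then show ?thesis by blast
  qed
  then show ?thesis by (metis surj_def)
qed

lemma surj_sum_sinh:
  fixes c :: "real \<Rightarrow> real"
  assumes S: "finite S" "S \<noteq> {}" "S \<subseteq> {0<..}" and c: "\<And>a. a \<in> S \<Longrightarrow> c a \<noteq> 0"
  shows "surj (\<lambda>y. \<Sum>a\<in>S. c a * sinh (a * y))"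
proof -
  define m where "m = Max S"
  have m: "m \<in> S" "m > 0" "\<And>a. a \<in> S \<Longrightarrow> a \<le> m"
    using Max_in[OF S(1,2)] S(3) Max_ge[OF S(1)] by (auto simp only: m_def greaterThan_iff)
  \<comment> \<open>The coefficients stay a parameter, so that a negative leading coefficient can be
    handled by negating all of them.\<close>
  define h where "h d y = (\<Sum>a\<in>S. d a * sinh (a * y))" for d :: "real \<Rightarrow> real" and y
  have surj: "surj (h d)" if d: "d m > 0" for d
  proof (rule surj_odd_continuous)
    show "continuous_on UNIV (h d)"
      unfolding h_def by (intro continuous_intros)
    show "h d (- y) = - h d y" for y
      by (simp add: h_def sum_negf)
    \<comment> \<open>This is 2 sinh(a y) / exp(m y): after division by the dominant exponential
      only the term with the largest exponent survives.\<close>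
    have lim: "((\<lambda>y. exp ((a - m) * y) - exp (- ((a + m) * y))) \<longlongrightarrow> (if a = m then 1 else 0)) at_top"
      if "a \<in> S" for a
    proof -
      have decay: "((\<lambda>y. exp (- (b * y))) \<longlongrightarrow> 0) at_top" if "b > 0" for b :: real
        using that by real_asymp
      have "((\<lambda>y. exp ((a - m) * y)) \<longlongrightarrow> (if a = m then 1 else 0)) at_top"
        using decay[of "m - a"] m(3)[OF that] by (cases "a = m") (auto simp: algebra_simps)
      from tendsto_diff[OF this decay[of "a + m"]] show ?thesis
        using S(3) that m(2) by auto
    qed
    have "((\<lambda>y. \<Sum>a\<in>S. d a * (exp ((a - m) * y) - exp (- ((a + m) * y))) / 2) \<longlongrightarrow>
        (\<Sum>a\<in>S. d a * (if a = m then 1 else 0) / 2)) at_top"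
      by (intro tendsto_sum tendsto_divide tendsto_mult tendsto_const lim) auto
    moreover have "(\<Sum>a\<in>S. d a * (if a = m then 1 else 0) / 2) = (\<Sum>a\<in>S. if a = m then d m / 2 else 0)"
      by (rule sum.cong) auto
    ultimately have "((\<lambda>y. \<Sum>a\<in>S. d a * (exp ((a - m) * y) - exp (- ((a + m) * y))) / 2) \<longlongrightarrow> d m / 2) at_top"
      using m(1) S(1) by simp
    moreover have "filterlim (\<lambda>y. exp (m * y)) at_top at_top"
      using m(2) by real_asymp
    ultimately have "filterlim (\<lambda>y. (\<Sum>a\<in>S. d a * (exp ((a - m) * y) - exp (- ((a + m) * y))) / 2) * exp (m * y))
        at_top at_top"
      using d by (intro filterlim_tendsto_pos_mult_at_top[where c = "d m / 2"]) auto
    moreover have "(\<Sum>a\<in>S. d a * (exp ((a - m) * y) - exp (- ((a + m) * y))) / 2) * exp (m * y) = h d y" for y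
      unfolding h_def sum_distrib_right
    proof (rule sum.cong[OF refl])
      fix a
      have "exp ((a - m) * y) * exp (m * y) = exp (a * y)"
           "exp (- ((a + m) * y)) * exp (m * y) = exp (- (a * y))"
        by (simp_all add: exp_add[symmetric] algebra_simps)
      then show "d a * (exp ((a - m) * y) - exp (- ((a + m) * y))) / 2 * exp (m * y) = d a * sinh (a * y)"
        by (simp add: sinh_field_def left_diff_distrib mult.assoc)
    qed
    ultimately show "filterlim (h d) at_top at_top"
      by simp
  qed
  have "surj (h c)"
  proof (cases "c m > 0")
    case False
    then have "surj (h (\<lambda>a. - c a))"
      using c[OF m(1)] by (intro surj) auto
    moreover have "h (\<lambda>a. - c a) y = - h c y" for y
      by (simp add: h_def sum_negf)
    ultimately have "\<exists>y. - h c y = - z" for z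
      by (metis surjD)
    then show ?thesis by (metis neg_equal_iff_equal surj_def)
  qed (rule surj)
  then show ?thesis by (simp add: h_def[abs_def])
qed

section \<open>The subspace and its Hamel basis\<close>

theorem theorem3p1:
  shows "lineable continuum MES"
proof -
  obtain f where f: "everywhere_surjective f" "negligible {x. f x \<noteq> 0}"
    using exists_everywhere_surjective_null_support by blast
  define g where "g a = (\<lambda>x. sinh (a * f x))" for a :: real
  let ?B = "g ` {0<..}"
  have inj: "inj g"
  proof (rule injI)
    fix a b assume eq: "g a = g b"
    \<comment> \<open>At such a point \<open>g a\<close> takes the value sinh(a), which determines
      a.\<close>
    obtain x where "f x = 1"
      using f(1) unfolding everywhere_surjective_def by (metis UNIV_I UNIV_not_empty imageE open_UNIV)
    with fun_cong[OF eq, of x] show "a = b" by (simp add: g_def)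
  qed
  \<comment> \<open>This gives independence, since 0 is not in \<open>MES\<close>, and also the
    inclusion of the nonzero part of the span.\<close>
  have comb: "(\<Sum>v | u v \<noteq> 0. u v *\<^sub>R v) \<in> MES"
    if u: "finite {v. u v \<noteq> 0}" "{v. u v \<noteq> 0} \<noteq> {}" "\<forall>v. u v \<noteq> 0 \<longrightarrow> v \<in> ?B" for u
  proof -
    \<comment> \<open>The exponents that occur in the combination; as \<open>g\<close> is injective,
      the sum over vectors can be reindexed by them.\<close>
    define S where "S = {a \<in> {0<..}. u (g a) \<noteq> 0}"
    have gS: "g ` S = {v. u v \<noteq> 0}"
      using u(3) by (auto simp: S_def)
    have fin: "finite S"
      using u(1) gS inj by (metis finite_image_iff inj_on_subset subset_UNIV)
    have sum_apply: "(\<Sum>i\<in>I. F i) x = (\<Sum>i\<in>I. F i x)" if "finite I"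
      for I and F :: "real \<Rightarrow> real \<Rightarrow> real" and x
      using that by (induction I rule: finite_induct) auto
    have "(\<Sum>v | u v \<noteq> 0. u v *\<^sub>R v) = (\<Sum>a\<in>S. u (g a) *\<^sub>R g a)"
      unfolding gS[symmetric] using inj by (subst sum.reindex) (auto intro: inj_on_subset)
    also have "\<dots> = (\<lambda>x. (\<lambda>y. \<Sum>a\<in>S. u (g a) * sinh (a * y)) (f x))"
      by (rule ext) (simp add: sum_apply[OF fin] scaleR_fun_def g_def)
    also have "\<dots> \<in> MES"
      using u(2) gS fin by (intro MES_comp f surj_sum_sinh) (auto simp: S_def)
    finally show ?thesis .
  qed
  have zero: "0 \<notin> MES"
    by (auto simp: MES_def everywhere_surjective_def zero_fun_def dest!: spec[of _ UNIV])
  have "independent ?B"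
    unfolding independent_alt
  proof (intro allI impI)
    fix u v
    assume u: "finite {v. u v \<noteq> 0}" "{v. u v \<noteq> 0} \<subseteq> ?B" "(\<Sum>v | u v \<noteq> 0. u v *\<^sub>R v) = 0"
    show "u v = 0"
    proof (rule ccontr)
      assume "u v \<noteq> 0"
      with u(2) have "(\<Sum>v | u v \<noteq> 0. u v *\<^sub>R v) \<in> MES"
        by (intro comb u(1)) blast+
      with u(3) zero show False by simp
    qed
  qed
  moreover have "span ?B - {0} \<subseteq> MES"
    unfolding span_explicit' using comb by force
  moreover have "|?B| =o continuum"
  proof -
    \<comment> \<open>The exponential reparametrises the positive exponents by all reals.\<close>
    have "inj_on (g \<circ> exp) UNIV"
      by (intro comp_inj_on inj_on_subset[OF inj]) (auto simp: inj_on_def)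
    moreover have "(g \<circ> exp) ` UNIV = ?B"
      by (metis exp_gt_zero exp_ln greaterThan_iff image_comp image_subsetI rangeI subset_antisym subsetI image_mono)
    ultimately have "bij_betw (g \<circ> exp) UNIV ?B"
      by (simp add: bij_betw_def)
    then show ?thesis
      using card_of_ordIso ordIso_symmetric by blast
  qed
  ultimately show ?thesis
    unfolding lineable_def has_dimension_def
    by (intro exI[of _ "span ?B"]) (auto simp: subspace_span)
qed

end
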